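(* For any $\sigma>0$, define $\phi_\sigma:\mathbb{R}\to\mathbb{R}$ as the convolution of the Gaussian $K_\sigma$ with the absolute value function, i.e. $$\phi_\sigma(t) := (K_\sigma * |\cdot|)(t) = \frac{1}{\sqrt{2\pi\sigma^2}}\int_{-\infty}^{\infty} |t-s|\exp\left(-\frac{s^2}{2\sigma^2}\right)\,\mathrm{d}s,\qquad t\in\mathbb{R}.$$ Then for all $t\in\mathbb{R}$: $$\phi_\sigma(t) = t\,\operatorname{erf}\left(\frac{t}{\sqrt{2}\,\sigma}\right) + \sqrt{\frac{2}{\pi}}\,\sigma\exp\left(-\frac{t^2}{2\sigma^2}\right),$$ $$\frac{\mathrm{d}}{\mathrm{d}t}\,\phi_\sigma(t) = \operatorname{erf}\left(\frac{t}{\sqrt{2}\,\sigma}\right).$$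
   Context: For $\sigma>0$, $K_\sigma:\mathbb{R}\to\mathbb{R}$ is the Gaussian $K_\sigma(t)=\frac{1}{\sqrt{2\pi\sigma^2}}\exp\left(-\frac{t^2}{2\sigma^2}\right)$. The error function is $\operatorname{erf}(t)=\frac{2}{\sqrt{\pi}}\int_0^t\exp(-u^2)\,\mathrm{d}u$ for all $t\in\mathbb{R}$. *)

theory Defs
  imports "HOL-Probability.Probability"
begin

(* The Gaussian K_\<sigma> is the library's normal_density 0 \<sigma>. *)

(* The interval integral is oriented, so the definition is also the intended one for t < 0. *)
definition erf :: "real \<Rightarrow> real" where
  "erf t = 2 / sqrt pi * (LBINT u=0..ereal t. exp (- u\<^sup>2))"

(* Convolution of functions; the library's convolution is that of measures. *)
definition fun_conv :: "(real \<Rightarrow> real) \<Rightarrow> (real \<Rightarrow> real) \<Rightarrow> real \<Rightarrow> real" where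
  "fun_conv f g t = (LBINT s. f s * g (t - s))"

definition phi :: "real \<Rightarrow> real \<Rightarrow> real" where
  "phi \<sigma> = fun_conv (normal_density 0 \<sigma>) abs"

lemma phi_eq:
  "phi \<sigma> t = 1 / sqrt (2 * pi * \<sigma>\<^sup>2) * (LBINT s. \<bar>t - s\<bar> * exp (- s\<^sup>2 / (2 * \<sigma>\<^sup>2)))"
proof -
  have "phi \<sigma> t =
      (LBINT s. 1 / sqrt (2 * pi * \<sigma>\<^sup>2) * (\<bar>t - s\<bar> * exp (- s\<^sup>2 / (2 * \<sigma>\<^sup>2))))"
    unfolding phi_def fun_conv_def normal_density_def
    by (rule Bochner_Integration.integral_cong) (simp_all add: mult_ac)
  also have "\<dots> = 1 / sqrt (2 * pi * \<sigma>\<^sup>2) * (LBINT s. \<bar>t - s\<bar> * exp (- s\<^sup>2 / (2 * \<sigma>\<^sup>2)))"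
    by (rule integral_mult_right_zero)
  finally show ?thesis .
qed

end

theory Submission
  imports Defs
begin

text \<open>
  Write \<open>K\<close> for the Gaussian. In the sense of distributions the second derivative of the absolute
  value is twice the Dirac mass at \<open>0\<close>, so the second derivative of \<open>K * \<bar>\<cdot>\<bar>\<close> is \<open>2 K\<close>. Taylor
  expansion at \<open>t = 0\<close> with integral remainder therefore suggests
  that \<open>(K * \<bar>\<cdot>\<bar>)(t)\<close> is the sum of \<open>\<integral> K(s) \<bar>s\<bar> ds\<close>, of \<open>- t \<integral> K(s) sgn(s) ds\<close>, and of twice the
  integral of \<open>(t - s) K(s)\<close> over \<open>s\<close> from \<open>0\<close> to \<open>t\<close>.
  This needs no distributions: it is the integral against \<open>K\<close> of a pointwise identity for
  \<open>\<bar>t - s\<bar>\<close> (\<open>abs_diff_taylor\<close>). The first term is an absolute moment of the normal distribution and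
  the second vanishes by symmetry. The remainder is an integral over a bounded interval, and
  \<open>t erf(s / (sqrt 2 \<sigma>)) / 2 + \<sigma>\<^sup>2 K(s)\<close> is an antiderivative of \<open>(t - s) K(s)\<close> in \<open>s\<close>, because
  \<open>K'(s) = - s K(s) / \<sigma>\<^sup>2\<close>. So the limits of \<open>erf\<close> at infinity never enter. The value of this
  antiderivative at \<open>s = 0\<close> cancels the absolute moment, which leaves the closed form.

  Differentiating the closed form yields \<open>erf(t / (sqrt 2 \<sigma>))\<close>, since the remaining two terms,
  \<open>2 t K(t)\<close> and \<open>2 \<sigma>\<^sup>2 K'(t)\<close>, cancel.
\<close>

section \<open>Derivatives of the error function and of the Gaussian\<close>

lemma has_real_derivative_erf:
  "(erf has_real_derivative 2 / sqrt pi * exp (- x\<^sup>2)) (at x)"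
proof -
  define b where "b = \<bar>x\<bar> + 1"
  have "((\<lambda>u. LBINT y=ereal 0..ereal u. exp (- y\<^sup>2)) has_vector_derivative exp (- x\<^sup>2))
      (at x within {-b..b})"
    by (rule interval_integral_FTC2) (auto simp: b_def intro!: continuous_intros)
  moreover have "at x within {-b..b} = at x"
    by (rule at_within_interior) (auto simp: b_def)
  ultimately have
    "((\<lambda>u. LBINT y=0..ereal u. exp (- y\<^sup>2)) has_real_derivative exp (- x\<^sup>2)) (at x)"
    by (simp add: has_real_derivative_iff_has_vector_derivative zero_ereal_def)
  from DERIV_cmult[OF this, of "2 / sqrt pi"] show ?thesis
    by (simp add: erf_def[abs_def])
qed

lemma erf_0 [simp]: "erf 0 = 0"
  by (simp add: erf_def flip: zero_ereal_def)

lemma has_real_derivative_erf_scaled: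
  assumes "\<sigma> > 0"
  shows "((\<lambda>s. erf (s / (sqrt 2 * \<sigma>))) has_real_derivative 2 * normal_density 0 \<sigma> s) (at s)"
proof -
  have "((\<lambda>s. s / (sqrt 2 * \<sigma>)) has_real_derivative 1 / (sqrt 2 * \<sigma>)) (at s)"
    using assms by (auto intro!: derivative_eq_intros)
  from DERIV_chain2[OF has_real_derivative_erf this] show ?thesis
    using assms
    by (simp add: normal_density_def real_sqrt_mult power_divide power_mult_distrib field_simps)
qed

lemma has_real_derivative_normal_density:
  assumes "\<sigma> > 0"
  shows "(normal_density 0 \<sigma> has_real_derivative - s * normal_density 0 \<sigma> s / \<sigma>\<^sup>2) (at s)"
  unfolding normal_density_def
  by (rule derivative_eq_intros refl | use assms in \<open>simp add: field_simps\<close>)+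

section \<open>Expansion of the convolution at the origin\<close>

text \<open>
  For \<open>s \<noteq> 0\<close> the last term is the integral remainder in the expansion of
  \<open>\<lambda>t. \<bar>t - s\<bar>\<close> at \<open>t = 0\<close>: the slope jumps by \<open>2\<close> where \<open>t\<close> passes \<open>s\<close>. The interval is
  written so that the identity covers both signs of \<open>t\<close>.
\<close>

lemma abs_diff_taylor:
  fixes s t :: real
  assumes "s \<noteq> 0"
  shows "\<bar>t - s\<bar> = \<bar>s\<bar> - t * sgn s + 2 * (indicator {min 0 t..max 0 t} s * \<bar>t - s\<bar>)"
  using assms by (auto simp: indicator_def sgn_if abs_if min_def max_def)

lemma integrable_normal_density_sgn:
  "\<sigma> > 0 \<Longrightarrow> integrable lborel (\<lambda>s. normal_density 0 \<sigma> s * sgn s)"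
  by (rule Bochner_Integration.integrable_bound[OF integrable_normal_density[of \<sigma> 0]])
    (auto simp: abs_mult sgn_if)

lemma integral_normal_density_sgn:
  "(LBINT s. normal_density 0 \<sigma> s * sgn s) = 0"
proof -
  have "(LBINT s. normal_density 0 \<sigma> s * sgn s) =
      (LBINT s. normal_density 0 \<sigma> (0 + -1 * s) * sgn (0 + -1 * s))"
    by (subst lborel_integral_real_affine[where c = "-1" and t = 0]) simp_all
  also have "\<dots> = - (LBINT s. normal_density 0 \<sigma> s * sgn s)"
    by (simp add: normal_density_def sgn_minus)
  finally show ?thesis by simp
qed

text \<open>
  On the interval \<open>t - s\<close> vanishes or has the sign of \<open>t\<close>. This sign also accounts for the order of the
  endpoints \<open>0\<close> and \<open>t\<close>, so one formula serves both signs.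
\<close>

lemma taylor_remainder_normal_density:
  fixes t :: real
  assumes "\<sigma> > 0"
  defines "I \<equiv> {min 0 t..max 0 t}"
  shows "integrable lborel (\<lambda>s. indicator I s * (normal_density 0 \<sigma> s * \<bar>t - s\<bar>))"
    and "(LBINT s. indicator I s * (normal_density 0 \<sigma> s * \<bar>t - s\<bar>)) =
      t * erf (t / (sqrt 2 * \<sigma>)) / 2 + \<sigma>\<^sup>2 * normal_density 0 \<sigma> t - \<sigma>\<^sup>2 * normal_density 0 \<sigma> 0"
proof -
  define K where "K = normal_density 0 \<sigma>"
  define F where "F s = t * erf (s / (sqrt 2 * \<sigma>)) / 2 + \<sigma>\<^sup>2 * K s" for s
  have cont: "continuous_on I (\<lambda>s. K s * \<bar>t - s\<bar>)"
    unfolding K_def normal_density_def using assms by (auto intro!: continuous_intros)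
  from borel_integrable_atLeastAtMost'[OF cont[unfolded I_def]]
  show "integrable lborel (\<lambda>s. indicator I s * (normal_density 0 \<sigma> s * \<bar>t - s\<bar>))"
    by (simp add: set_integrable_def I_def K_def)
  have F: "(F has_real_derivative (t - s) * K s) (at s)" for s
    using assms(1)
      DERIV_add[OF DERIV_cmult[OF has_real_derivative_erf_scaled[OF assms(1)], of "t / 2" s]
        DERIV_cmult[OF has_real_derivative_normal_density[OF assms(1)], of "\<sigma>\<^sup>2" s]]
    by (simp add: F_def[abs_def] K_def algebra_simps)
  have "(LBINT s. indicator I s *\<^sub>R (K s * \<bar>t - s\<bar>)) =
      sgn t * F (max 0 t) - sgn t * F (min 0 t)"
    unfolding I_def
  proof (rule integral_FTC_atLeastAtMost[OF _ _ cont[unfolded I_def]])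
    fix s assume s: "min 0 t \<le> s" "s \<le> max 0 t"
    have "((\<lambda>s. sgn t * F s) has_real_derivative sgn t * ((t - s) * K s)) (at s)"
      by (rule DERIV_cmult[OF F])
    also have "sgn t * ((t - s) * K s) = K s * \<bar>t - s\<bar>"
      using s by (auto simp: sgn_if abs_if min_def max_def split: if_splits)
    finally show "((\<lambda>s. sgn t * F s) has_vector_derivative K s * \<bar>t - s\<bar>)
        (at s within {min 0 t..max 0 t})"
      by (auto simp: has_real_derivative_iff_has_vector_derivative
          intro: has_vector_derivative_at_within)
  qed simp
  also have "\<dots> = F t - F 0"
    by (auto simp: sgn_if min_def max_def)
  finally show "(LBINT s. indicator I s * (normal_density 0 \<sigma> s * \<bar>t - s\<bar>)) =
      t * erf (t / (sqrt 2 * \<sigma>)) / 2 + \<sigma>\<^sup>2 * normal_density 0 \<sigma> t - \<sigma>\<^sup>2 * normal_density 0 \<sigma> 0"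
    by (simp add: F_def K_def)
qed

section \<open>The closed form\<close>

lemma two_variance_normal_density:
  assumes "\<sigma> > 0"
  shows "2 * \<sigma>\<^sup>2 * normal_density 0 \<sigma> t = sqrt (2 / pi) * \<sigma> * exp (- t\<^sup>2 / (2 * \<sigma>\<^sup>2))"
proof -
  have "2 * \<sigma>\<^sup>2 / sqrt (2 * pi * \<sigma>\<^sup>2) = sqrt (2 / pi) * \<sigma>"
    using assms by (simp add: real_sqrt_mult real_sqrt_divide field_simps power2_eq_square)
  from arg_cong[OF this, of "\<lambda>c. c * exp (- t\<^sup>2 / (2 * \<sigma>\<^sup>2))"] show ?thesis
    by (simp add: normal_density_def)
qed

lemma phi_closed_form:
  assumes "\<sigma> > 0"
  shows "phi \<sigma> t = t * erf (t / (sqrt 2 * \<sigma>)) + 2 * \<sigma>\<^sup>2 * normal_density 0 \<sigma> t"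
proof -
  define K where "K = normal_density 0 \<sigma>"
  define R where "R s = indicator {min 0 t..max 0 t} s * (K s * \<bar>t - s\<bar>)" for s
  have moment: "has_bochner_integral lborel (\<lambda>s. K s * \<bar>s\<bar>) (2 * \<sigma>\<^sup>2 * K 0)"
    using normal_moment_abs_odd[OF assms, of 0 0] two_variance_normal_density[OF assms, of 0]
    by (simp add: K_def mult.commute)
  have symmetry: "has_bochner_integral lborel (\<lambda>s. K s * sgn s) 0"
    using integrable_normal_density_sgn[OF assms] integral_normal_density_sgn[of \<sigma>]
    by (simp add: K_def has_bochner_integral_iff)
  have remainder: "has_bochner_integral lborel R
      (t * erf (t / (sqrt 2 * \<sigma>)) / 2 + \<sigma>\<^sup>2 * K t - \<sigma>\<^sup>2 * K 0)"
    using taylor_remainder_normal_density[OF assms, of t]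
    by (simp add: R_def[abs_def] K_def has_bochner_integral_iff)
  have expansion: "K s * \<bar>t - s\<bar> = K s * \<bar>s\<bar> - t * (K s * sgn s) + 2 * R s" if "s \<noteq> 0" for s
    using arg_cong[OF abs_diff_taylor[OF that, of t], of "\<lambda>x. K s * x"]
    by (simp add: R_def algebra_simps)
  have [measurable]: "R \<in> borel_measurable lborel" "K \<in> borel_measurable lborel"
    by (auto simp: R_def[abs_def] K_def)
  have "phi \<sigma> t = (LBINT s. K s * \<bar>t - s\<bar>)"
    by (simp add: phi_def fun_conv_def K_def)
  also have "\<dots> = (LBINT s. K s * \<bar>s\<bar> - t * (K s * sgn s) + 2 * R s)"
    by (rule integral_cong_AE; (measurable)?)
      (use AE_lborel_singleton[of 0] in \<open>auto simp: expansion elim!: eventually_mono\<close>)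
  also have "\<dots> = 2 * \<sigma>\<^sup>2 * K 0 - t * 0
      + 2 * (t * erf (t / (sqrt 2 * \<sigma>)) / 2 + \<sigma>\<^sup>2 * K t - \<sigma>\<^sup>2 * K 0)"
    by (intro has_bochner_integral_integral_eq has_bochner_integral_add has_bochner_integral_diff
        has_bochner_integral_mult_right moment symmetry remainder)
  also have "\<dots> = t * erf (t / (sqrt 2 * \<sigma>)) + 2 * \<sigma>\<^sup>2 * K t"
    by (simp add: algebra_simps)
  finally show ?thesis by (simp add: K_def)
qed

theorem lemma2p4:
  fixes \<sigma> :: real
  assumes "\<sigma> > 0"
  shows "\<forall>t::real.
    phi \<sigma> t = t * erf (t / (sqrt 2 * \<sigma>)) + sqrt (2 / pi) * \<sigma> * exp (- t\<^sup>2 / (2 * \<sigma>\<^sup>2)) \<and>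
    (phi \<sigma> has_real_derivative erf (t / (sqrt 2 * \<sigma>))) (at t)"
proof (intro allI conjI)
  fix t :: real
  show "phi \<sigma> t = t * erf (t / (sqrt 2 * \<sigma>)) + sqrt (2 / pi) * \<sigma> * exp (- t\<^sup>2 / (2 * \<sigma>\<^sup>2))"
    using phi_closed_form[OF assms] two_variance_normal_density[OF assms] by simp
  have "phi \<sigma> = (\<lambda>t. t * erf (t / (sqrt 2 * \<sigma>)) + 2 * \<sigma>\<^sup>2 * normal_density 0 \<sigma> t)"
    using phi_closed_form[OF assms] by blast
  moreover have "((\<lambda>t. t * erf (t / (sqrt 2 * \<sigma>)) + 2 * \<sigma>\<^sup>2 * normal_density 0 \<sigma> t)
      has_real_derivative erf (t / (sqrt 2 * \<sigma>))) (at t)"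
    by (rule derivative_eq_intros has_real_derivative_erf_scaled
          has_real_derivative_normal_density assms refl)+
      (use assms in \<open>simp add: field_simps\<close>)
  ultimately show "(phi \<sigma> has_real_derivative erf (t / (sqrt 2 * \<sigma>))) (at t)"
    by simp
qed

end
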